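(* Let $(C,e,\lambda_1,\oplus_1)$ be the free Catalan structure, let $(\lambda_i,\oplus_i)_{i\ge 1}$ be the sequence of operations on $C$ obtained by iterating the secondary structure construction, and let $M=h\circ\mathrm{rev}\colon C\to C$, with $h$ and $\mathrm{rev}$ defined from $(\lambda_1,\oplus_1)$. For every nonnegative integer $p$, $$(\lambda_{p+1},\oplus_{p+1})=(\lambda_1,\oplus_1)\quad\Longleftrightarrow\quad M^p=\operatorname{id}\text{ on }C.$$
   Context: A Catalan structure is a quadruple $(C,e,\lambda,\oplus)$ where $C=\bigsqcup_{n\ge 0}C_n$ with $C_0=\{e\}$ ($|t|=n$ for $t\in C_n$), $\lambda\colon C_n\to C_{n+1}$, $\oplus\colon C_m\times C_n\to C_{m+n}$, $\oplus$ is associative with two-sided identity $e$, and every $t\in C$ can be written uniquely in exactly one of three forms: $t=e$; $t=\lambda(s)$ with $s\in C$ (indecomposable); $t=u\oplus v$ with $u$ indecomposable and $v\in C\setminus C_0$ (decomposable). Hence every nonempty $t$ is uniquely $\lambda(u)\oplus v$ ($v=e$ allowed). The free Catalan structure is realized by the formal expressions $e$, $\lambda(t)$, $\lambda(u)\oplus v$ with $v\ne e$; it is isomorphic to rooted plane trees written as lists of children, with $e=[\,]$, $\lambda(T)=[T]$, $\oplus$ = concatenation of child lists. Secondary structure construction: from a Catalan structure $(C,e,\lambda_i,\oplus_i)$ define $\lambda_{i+1}(t)=t\oplus_i\lambda_i(e)$ and $\oplus_{i+1}$ recursively in the first argument by $e\oplus_{i+1}v=v$, $\lambda_i(u)\oplus_{i+1}v=\lambda_i(u\oplus_{i+1}v)$,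 $(t\oplus_i u)\oplus_{i+1}v=t\oplus_i(u\oplus_{i+1}v)$ for $t,u\neq e$. Then $(C,e,\lambda_{i+1},\oplus_{i+1})$ is again a Catalan structure, so the construction can be iterated. Write $\lambda=\lambda_1$, $\oplus=\oplus_1$, $\gamma=\lambda_2$, $\ominus=\oplus_2$. The maps: $h(e)=e$, $h(\lambda(u)\oplus v)=h(v)\ominus\gamma(h(u))$; $\mathrm{rev}(e)=e$, $\mathrm{rev}(\lambda(u)\oplus v)=\mathrm{rev}(v)\oplus\lambda(\mathrm{rev}(u))$. Both are size-preserving involutions of $C$. *)

theory Defs
  imports Main
begin

section \<open>Catalan structures\<close>

text \<open>
  The carrier C is the whole type; \<open>deg t\<close> is the size |t|, so that C_n is the set of all t
  with \<open>deg t = n\<close>. The last four assumptions spell out that every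
  element has exactly one of the three forms e, \<open>lam s\<close>, and \<open>opl u v\<close> with u indecomposable
  (that is, u in the range of \<open>lam\<close>) and v distinct from e, and that it has this form in only
  one way. That e differs from the other two forms is a consequence of the assumptions on
  \<open>deg\<close>.
\<close>

locale catalan_structure =
  fixes deg :: "'a \<Rightarrow> nat" and e :: 'a and lam :: "'a \<Rightarrow> 'a" and opl :: "'a \<Rightarrow> 'a \<Rightarrow> 'a"
  assumes deg_0_iff: "deg t = 0 \<longleftrightarrow> t = e"
    and deg_lam: "deg (lam t) = deg t + 1"
    and deg_opl: "deg (opl s t) = deg s + deg t"
    and assoc: "opl (opl s t) u = opl s (opl t u)"
    and left_id: "opl e t = t"
    and right_id: "opl t e = t"
    and forms: "t = e \<or> t \<in> range lam \<or> (\<exists>u \<in> range lam. \<exists>v. v \<noteq> e \<and> t = opl u v)"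
    and lam_unique: "lam s = lam t \<Longrightarrow> s = t"
    and lam_neq_opl: "u \<in> range lam \<Longrightarrow> v \<noteq> e \<Longrightarrow> lam s \<noteq> opl u v"
    and opl_unique: "u \<in> range lam \<Longrightarrow> u' \<in> range lam \<Longrightarrow> v \<noteq> e \<Longrightarrow> v' \<noteq> e \<Longrightarrow>
      opl u v = opl u' v' \<Longrightarrow> u = u' \<and> v = v'"

section \<open>The secondary structure\<close>

definition secondary_rec ::
  "'a \<Rightarrow> ('a \<Rightarrow> 'a) \<Rightarrow> ('a \<Rightarrow> 'a \<Rightarrow> 'a) \<Rightarrow> ('a \<Rightarrow> 'a \<Rightarrow> 'a) \<Rightarrow> bool" where
  "secondary_rec e lam opl f \<longleftrightarrow>
     (\<forall>v. f e v = v) \<and>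
     (\<forall>u v. f (lam u) v = lam (f u v)) \<and>
     (\<forall>t u v. t \<noteq> e \<longrightarrow> u \<noteq> e \<longrightarrow> f (opl t u) v = opl t (f u v))"

text \<open>
  The description operator is meaningful only for Catalan structures, where the recursion
  equations have exactly one solution (\<open>ex1_secondary_rec\<close> below).
\<close>

definition secondary_opl :: "'a \<Rightarrow> ('a \<Rightarrow> 'a) \<Rightarrow> ('a \<Rightarrow> 'a \<Rightarrow> 'a) \<Rightarrow> 'a \<Rightarrow> 'a \<Rightarrow> 'a" where
  "secondary_opl e lam opl = (THE f. secondary_rec e lam opl f)"

definition secondary_lam :: "'a \<Rightarrow> ('a \<Rightarrow> 'a) \<Rightarrow> ('a \<Rightarrow> 'a \<Rightarrow> 'a) \<Rightarrow> 'a \<Rightarrow> 'a" where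
  "secondary_lam e lam opl t = opl t (lam e)"

definition secondary ::
  "'a \<Rightarrow> ('a \<Rightarrow> 'a) \<times> ('a \<Rightarrow> 'a \<Rightarrow> 'a) \<Rightarrow> ('a \<Rightarrow> 'a) \<times> ('a \<Rightarrow> 'a \<Rightarrow> 'a)" where
  "secondary e = (\<lambda>(lam, opl). (secondary_lam e lam opl, secondary_opl e lam opl))"

context catalan_structure
begin

lemma lam_neq_e: "lam t \<noteq> e"
  using deg_0_iff[of "lam t"] deg_lam[of t] by simp

lemma opl_eq_e_iff: "opl s t = e \<longleftrightarrow> s = e \<and> t = e"
  using deg_0_iff[of "opl s t"] deg_0_iff[of s] deg_0_iff[of t] deg_opl[of s t] by simp

lemma cons_exists: "t \<noteq> e \<Longrightarrow> \<exists>u v. t = opl (lam u) v"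
  using forms[of t] right_id by (metis rangeE)

lemma cons_unique: "opl (lam u) v = opl (lam u') v' \<longleftrightarrow> u = u' \<and> v = v'"
  using lam_neq_opl[of "lam u" v u'] lam_neq_opl[of "lam u'" v' u]
    opl_unique[of "lam u" "lam u'" v v'] lam_unique right_id
  by (metis rangeI)

lemma cons_induct [case_names e cons]:
  assumes "P e" and "\<And>u v. P u \<Longrightarrow> P v \<Longrightarrow> P (opl (lam u) v)"
  shows "P t"
proof (induction "deg t" arbitrary: t rule: less_induct)
  case less
  show ?case
  proof (cases "t = e")
    case False
    then obtain u v where t: "t = opl (lam u) v"
      using cons_exists by blast
    have "deg u < deg t" "deg v < deg t"
      by (simp_all add: t deg_opl deg_lam)
    with less assms(2) t show ?thesis by blast
  qed (simp add: assms(1))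
qed

lemma secondary_rec_unique:
  assumes f: "secondary_rec e lam opl f" and g: "secondary_rec e lam opl g"
  shows "f = g"
proof (intro ext)
  fix t v
  show "f t v = g t v"
  proof (induction t rule: cons_induct)
    case e
    then show ?case using f g by (simp add: secondary_rec_def)
  next
    case (cons a b)
    then show ?case
      using f g by (cases "b = e") (simp_all add: secondary_rec_def right_id lam_neq_e)
  qed
qed

text \<open>
  \<open>graft\<close> only serves to witness that the recursion equations have a solution.
\<close>

definition hd_child :: "'a \<Rightarrow> 'a" where
  "hd_child t = (THE u. \<exists>v. t = opl (lam u) v)"

definition rest :: "'a \<Rightarrow> 'a" where
  "rest t = (THE v. \<exists>u. t = opl (lam u) v)"

lemma hd_child_cons: "hd_child (opl (lam u) v) = u"
  by (auto simp: hd_child_def cons_unique)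

lemma rest_cons: "rest (opl (lam u) v) = v"
  by (auto simp: rest_def cons_unique)

function graft :: "'a \<Rightarrow> 'a \<Rightarrow> 'a" where
  "graft t v =
     (if t = e then v
      else if rest t = e then lam (graft (hd_child t) v)
      else opl (lam (hd_child t)) (graft (rest t) v))"
  by pat_completeness auto
termination
proof (relation "measure (\<lambda>(t, _). deg t)")
  fix t v
  assume "t \<noteq> e"
  then obtain a b where t: "t = opl (lam a) b"
    using cons_exists by blast
  show "((hd_child t, v), t, v) \<in> measure (\<lambda>(t, _). deg t)"
    and "((rest t, v), t, v) \<in> measure (\<lambda>(t, _). deg t)"
    by (simp_all add: t hd_child_cons rest_cons deg_opl deg_lam)
qed simp

declare graft.simps [simp del]

lemma graft_cons:
  "graft (opl (lam a) b) v = (if b = e then lam (graft a v) else opl (lam a) (graft b v))"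
  by (subst graft.simps) (simp add: hd_child_cons rest_cons opl_eq_e_iff lam_neq_e)

lemma secondary_rec_graft: "secondary_rec e lam opl graft"
  unfolding secondary_rec_def
proof (intro conjI allI impI)
  show "graft e v = v" for v
    by (simp add: graft.simps)
  show "graft (lam u) v = lam (graft u v)" for u v
    using graft_cons[of u e v] by (simp add: right_id)
  show "graft (opl t u) v = opl t (graft u v)" if "t \<noteq> e" "u \<noteq> e" for t u v
  proof -
    have "graft (opl t u) v = opl t (graft u v)"
    proof (induction t rule: cons_induct)
      case (cons a b)
      then show ?case
        using that(2) by (simp add: assoc graft_cons opl_eq_e_iff)
    qed (simp add: left_id)
    then show ?thesis .
  qed
qed

theorem ex1_secondary_rec: "\<exists>!f. secondary_rec e lam opl f"
  using secondary_rec_graft secondary_rec_unique by blast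

lemma secondary_rec_secondary_opl: "secondary_rec e lam opl (secondary_opl e lam opl)"
  unfolding secondary_opl_def by (rule theI'[OF ex1_secondary_rec])

lemma snoc_unique: "opl s (lam v) = opl s' (lam v') \<longleftrightarrow> s = s' \<and> v = v'"
proof (induction s arbitrary: s' rule: cons_induct)
  case e
  show ?case
  proof (cases "s' = e")
    case True
    then show ?thesis using lam_unique by (auto simp: left_id)
  next
    case False
    then obtain a b where "s' = opl (lam a) b" using cons_exists by blast
    moreover have "lam v \<noteq> opl (lam a) (opl b (lam v'))"
      using cons_unique[of v e a "opl b (lam v')"] opl_eq_e_iff lam_neq_e right_id by metis
    ultimately show ?thesis
      using False by (simp add: left_id assoc)
  qed
next
  case (cons a b)
  show ?case
  proof (cases "s' = e")
    case True
    moreover have "opl (lam a) (opl b (lam v)) \<noteq> lam v'"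
      using cons_unique[of a "opl b (lam v)" v' e] opl_eq_e_iff lam_neq_e right_id by metis
    moreover have "opl (lam a) b \<noteq> e"
      by (simp add: opl_eq_e_iff lam_neq_e)
    ultimately show ?thesis
      by (auto simp: left_id assoc)
  next
    case False
    then obtain a' b' where "s' = opl (lam a') b'" using cons_exists by blast
    then show ?thesis by (auto simp: assoc cons_unique cons.IH(2))
  qed
qed

lemma snoc_exists: "t \<noteq> e \<Longrightarrow> \<exists>s v. t = opl s (lam v)"
proof (induction t rule: cons_induct)
  case (cons a b)
  show ?case
  proof (cases "b = e")
    case True
    then show ?thesis by (metis left_id right_id)
  next
    case False
    then show ?thesis by (metis assoc cons.IH(2))
  qed
qed simp

theorem catalan_structure_secondary:
  "catalan_structure deg e (secondary_lam e lam opl) (secondary_opl e lam opl)"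
proof -
  let ?l = "secondary_lam e lam opl" and ?f = "secondary_opl e lam opl"
  have f_e: "?f e v = v"
    and f_lam: "?f (lam u) v = lam (?f u v)"
    and f_opl: "t \<noteq> e \<Longrightarrow> u \<noteq> e \<Longrightarrow> ?f (opl t u) v = opl t (?f u v)" for t u v
    using secondary_rec_secondary_opl by (simp_all add: secondary_rec_def)
  have f_cons: "?f (opl (lam a) b) v = (if b = e then lam (?f a v) else opl (lam a) (?f b v))"
    for a b v
    by (simp add: f_lam f_opl lam_neq_e right_id)
  have deg_e: "deg e = 0" by (simp add: deg_0_iff)
  have deg_f: "deg (?f t v) = deg t + deg v" for t v
    by (induction t rule: cons_induct) (simp_all add: f_e f_cons deg_e deg_opl deg_lam)
  have f_eq_e: "?f t v = e \<longleftrightarrow> t = e \<and> v = e" for t v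
    using deg_f[of t v] deg_0_iff by (metis add_is_0)
  have f_right: "?f t e = t" for t
    by (induction t rule: cons_induct) (simp_all add: f_e f_cons right_id)
  have f_assoc: "?f (?f t u) v = ?f t (?f u v)" for t u v
    by (induction t rule: cons_induct) (simp_all add: f_e f_cons f_lam f_eq_e)
  have snoc: "?f (?l s) v = opl s (lam v)" for s v
    by (cases "s = e") (simp_all add: secondary_lam_def f_lam f_opl f_e left_id lam_neq_e)
  have l: "?l s = ?f (?l s) e" for s by (simp add: f_right)
  show ?thesis
  proof
    fix s t u v u' v'
    show "deg (?l t) = deg t + 1"
      by (simp add: secondary_lam_def deg_opl deg_lam deg_e)
    show "t = e \<or> t \<in> range ?l \<or> (\<exists>u\<in>range ?l. \<exists>v. v \<noteq> e \<and> t = ?f u v)"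
    proof (cases "t = e")
      case False
      then obtain s v where "t = ?f (?l s) v" using snoc_exists snoc by metis
      then show ?thesis by (cases "v = e") (auto simp: f_right)
    qed simp
    show "?l s = ?l t \<Longrightarrow> s = t"
      by (subst (asm) (1 2) l) (simp add: snoc snoc_unique)
    show "u \<in> range ?l \<Longrightarrow> v \<noteq> e \<Longrightarrow> ?l s \<noteq> ?f u v"
      by (subst l) (auto simp: snoc snoc_unique)
    show "u \<in> range ?l \<Longrightarrow> u' \<in> range ?l \<Longrightarrow> v \<noteq> e \<Longrightarrow> v' \<noteq> e \<Longrightarrow> ?f u v = ?f u' v' \<Longrightarrow>
        u = u' \<and> v = v'"
      by (auto simp: snoc snoc_unique)
  qed (simp_all add: deg_0_iff deg_f f_assoc f_e f_right)
qed

end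

section \<open>The free Catalan structure\<close>

text \<open>Rooted plane trees, given by their lists of children.\<close>

datatype ptree = Node (children: "ptree list")

abbreviation empty_tree :: ptree where
  "empty_tree \<equiv> Node []"

definition lam1 :: "ptree \<Rightarrow> ptree" where
  "lam1 t = Node [t]"

definition oplus1 :: "ptree \<Rightarrow> ptree \<Rightarrow> ptree" where
  "oplus1 s t = Node (children s @ children t)"

text \<open>The number of edges.\<close>

primrec tree_deg :: "ptree \<Rightarrow> nat" where
  "tree_deg (Node ts) = sum_list (map (\<lambda>t. tree_deg t + 1) ts)"

lemma oplus1_lam1: "oplus1 (lam1 u) (Node v) = Node (u # v)"
  by (simp add: oplus1_def lam1_def)

interpretation free: catalan_structure tree_deg empty_tree lam1 oplus1
proof
  fix s t u v u' v' :: ptree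
  show "tree_deg t = 0 \<longleftrightarrow> t = empty_tree"
  proof (cases t)
    case (Node ts)
    then show ?thesis by (cases ts) simp_all
  qed
  show "tree_deg (oplus1 s t) = tree_deg s + tree_deg t"
    by (cases s; cases t) (simp add: oplus1_def)
  show "t = empty_tree \<or> t \<in> range lam1 \<or>
      (\<exists>u\<in>range lam1. \<exists>v. v \<noteq> empty_tree \<and> t = oplus1 u v)"
  proof (cases t)
    case (Node ts)
    show ?thesis
    proof (cases ts)
      case (Cons a as)
      then have "t = oplus1 (lam1 a) (Node as)" using Node by (simp add: oplus1_lam1)
      then show ?thesis by (cases "as = []") (auto simp: lam1_def oplus1_def)
    qed (simp add: Node)
  qed
  show "u \<in> range lam1 \<Longrightarrow> v \<noteq> empty_tree \<Longrightarrow> lam1 s \<noteq> oplus1 u v"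
    by (cases v) (auto simp: lam1_def oplus1_def)
  show "u \<in> range lam1 \<Longrightarrow> u' \<in> range lam1 \<Longrightarrow> v \<noteq> empty_tree \<Longrightarrow> v' \<noteq> empty_tree \<Longrightarrow>
      oplus1 u v = oplus1 u' v' \<Longrightarrow> u = u' \<and> v = v'"
    by (cases v; cases v') (auto simp: lam1_def oplus1_def)
qed (simp_all add: lam1_def oplus1_def)

text \<open>
  \<open>cat_ops i\<close> is the i-th pair of operations, with i starting at 1 (the value at 0 is
  irrelevant).
\<close>

definition cat_ops :: "nat \<Rightarrow> (ptree \<Rightarrow> ptree) \<times> (ptree \<Rightarrow> ptree \<Rightarrow> ptree)" where
  "cat_ops i = (secondary empty_tree ^^ (i - 1)) (lam1, oplus1)"

lemma cat_ops_1: "cat_ops 1 = (lam1, oplus1)"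
  by (simp add: cat_ops_def)

lemma cat_ops_Suc: "i \<ge> 1 \<Longrightarrow> cat_ops (Suc i) = secondary empty_tree (cat_ops i)"
  by (cases i) (simp_all add: cat_ops_def)

lemma catalan_structure_cat_ops:
  "i \<ge> 1 \<Longrightarrow> catalan_structure tree_deg empty_tree (fst (cat_ops i)) (snd (cat_ops i))"
proof (induction i rule: dec_induct)
  case base
  show ?case using free.catalan_structure_axioms by (simp add: cat_ops_def)
next
  case (step i)
  then show ?case
    using catalan_structure.catalan_structure_secondary[OF step.IH]
    by (simp add: cat_ops_Suc secondary_def case_prod_beta)
qed

definition gam :: "ptree \<Rightarrow> ptree" where
  "gam = fst (cat_ops 2)"

definition ominus :: "ptree \<Rightarrow> ptree \<Rightarrow> ptree" where
  "ominus = snd (cat_ops 2)"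

section \<open>The maps\<close>

text \<open>Here \<open>Node (u # v)\<close> is \<open>oplus1 (lam1 u) (Node v)\<close>, by \<open>oplus1_lam1\<close>.\<close>

fun h_map :: "ptree \<Rightarrow> ptree" where
  "h_map (Node []) = Node []"
| "h_map (Node (u # v)) = ominus (h_map (Node v)) (gam (h_map u))"

fun rev_map :: "ptree \<Rightarrow> ptree" where
  "rev_map (Node []) = Node []"
| "rev_map (Node (u # v)) = oplus1 (rev_map (Node v)) (lam1 (rev_map u))"

lemma h_map_decomp: "h_map (oplus1 (lam1 u) v) = ominus (h_map v) (gam (h_map u))"
  by (cases v) (simp add: oplus1_lam1)

lemma rev_map_decomp: "rev_map (oplus1 (lam1 u) v) = oplus1 (rev_map v) (lam1 (rev_map u))"
  by (cases v) (simp add: oplus1_lam1)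

definition M_map :: "ptree \<Rightarrow> ptree" where
  "M_map = h_map \<circ> rev_map"

end

(*
  rev is an anti-automorphism of the first structure and h is an anti-homomorphism from the first
  structure to the second, so M = h o rev is a homomorphism from the first to the second. The
  secondary construction is functorial, so M is a homomorphism from the i-th structure to the
  (i + 1)-st for every i, and M^p is one from the first structure to the (p + 1)-st. If these two
  coincide, M^p is an endomorphism of a structure without nontrivial endomorphisms; conversely, if
  M^p = id, then the identity is a homomorphism between them.
*)
theory Submission
  imports Defs
begin

text \<open>The operations come as pairs, so that values of \<open>secondary\<close> and
  \<open>cat_ops\<close> can be inserted directly.\<close>

definition catalan_hom ::
  "('a \<Rightarrow> 'b) \<Rightarrow> 'a \<Rightarrow> ('a \<Rightarrow> 'a) \<times> ('a \<Rightarrow> 'a \<Rightarrow> 'a) \<Rightarrow> 'b \<Rightarrow> ('b \<Rightarrow> 'b) \<times> ('b \<Rightarrow> 'b \<Rightarrow> 'b) \<Rightarrow> bool"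
where
  "catalan_hom \<phi> e S e' S' \<longleftrightarrow>
     \<phi> e = e' \<and> (\<forall>t. \<phi> (fst S t) = fst S' (\<phi> t)) \<and>
     (\<forall>s t. \<phi> (snd S s t) = snd S' (\<phi> s) (\<phi> t))"

lemma catalan_hom_id: "catalan_hom id e S e S"
  by (simp add: catalan_hom_def)

lemma catalan_hom_comp:
  "catalan_hom \<phi> e S e' S' \<Longrightarrow> catalan_hom \<psi> e' S' e'' S'' \<Longrightarrow> catalan_hom (\<psi> \<circ> \<phi>) e S e'' S''"
  by (simp add: catalan_hom_def)

lemma catalan_hom_id_imp_eq: "catalan_hom id e S e' S' \<Longrightarrow> S = S'"
  by (auto simp: catalan_hom_def prod_eq_iff fun_eq_iff)

context catalan_structure
begin

lemma secondary_opl_e: "secondary_opl e lam opl e v = v"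
  and secondary_opl_lam:
    "secondary_opl e lam opl (lam u) v = lam (secondary_opl e lam opl u v)"
  and secondary_opl_opl:
    "t \<noteq> e \<Longrightarrow> u \<noteq> e \<Longrightarrow>
      secondary_opl e lam opl (opl t u) v = opl t (secondary_opl e lam opl u v)"
  using secondary_rec_secondary_opl by (simp_all add: secondary_rec_def)

text \<open>Every element is generated from \<open>e\<close> by \<open>lam\<close> and
  \<open>opl\<close>, so a homomorphism is determined by these operations.\<close>

lemma catalan_hom_self_eq_id:
  assumes "catalan_hom \<phi> e (lam, opl) e (lam, opl)"
  shows "\<phi> = id"
proof
  show "\<phi> t = id t" for t
    using assms by (induction t rule: cons_induct) (simp_all add: catalan_hom_def)
qed

text \<open>A nonempty element \<open>opl (lam u) v\<close> has an image of the same shape, which is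
  nonempty in the target. This transfers the side conditions in the recursion for
  \<open>secondary_opl\<close>.\<close>

lemma catalan_hom_eq_e_iff:
  assumes "catalan_structure deg' e' lam' opl'"
    and "catalan_hom \<phi> e (lam, opl) e' (lam', opl')"
  shows "\<phi> t = e' \<longleftrightarrow> t = e"
proof (cases "t = e")
  case False
  then obtain u v where "t = opl (lam u) v"
    using cons_exists by blast
  then show ?thesis
    using assms False
    by (simp add: catalan_hom_def catalan_structure.opl_eq_e_iff catalan_structure.lam_neq_e)
qed (use assms in \<open>simp add: catalan_hom_def\<close>)

lemma catalan_hom_secondary:
  assumes S': "catalan_structure deg' e' lam' opl'"
    and \<phi>: "catalan_hom \<phi> e (lam, opl) e' (lam', opl')"
  shows "catalan_hom \<phi> e (secondary e (lam, opl)) e' (secondary e' (lam', opl'))"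
proof -
  interpret S': catalan_structure deg' e' lam' opl' by (rule S')
  have hom: "\<phi> e = e'" "\<phi> (lam t) = lam' (\<phi> t)" "\<phi> (opl s t) = opl' (\<phi> s) (\<phi> t)" for s t
    using \<phi> by (simp_all add: catalan_hom_def)
  have "\<phi> (secondary_opl e lam opl s t) = secondary_opl e' lam' opl' (\<phi> s) (\<phi> t)" for s t
  proof (induction s rule: cons_induct)
    case e
    then show ?case
      by (simp add: hom secondary_opl_e S'.secondary_opl_e)
  next
    case (cons u v)
    \<comment> \<open>If \<open>v = e\<close>, the element is \<open>lam u\<close> and the equation
      for \<open>lam\<close> applies. Otherwise the equation for \<open>opl\<close> applies on both
      sides, since \<open>\<phi> v\<close> is nonempty as well.\<close>
    then show ?case
      by (cases "v = e")
        (simp_all add: hom right_id S'.right_id lam_neq_e S'.lam_neq_e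
          catalan_hom_eq_e_iff[OF S' \<phi>] secondary_opl_lam S'.secondary_opl_lam
          secondary_opl_opl S'.secondary_opl_opl)
  qed
  then show ?thesis
    by (simp add: catalan_hom_def secondary_def secondary_lam_def hom)
qed

end

interpretation snd_structure: catalan_structure tree_deg empty_tree gam ominus
  using catalan_structure_cat_ops[of 2] by (simp add: gam_def ominus_def)

lemma h_map_lam1: "h_map (lam1 t) = gam (h_map t)"
  by (simp add: lam1_def snd_structure.left_id)

text \<open>\<open>h_map_decomp\<close> is the case of an indecomposable first argument;
  associativity of both operations extends it by induction on \<open>s\<close>.\<close>

lemma h_map_oplus1: "h_map (oplus1 s t) = ominus (h_map t) (h_map s)"
  by (induction s rule: free.cons_induct)
    (simp_all add: free.left_id snd_structure.right_id free.assoc h_map_decomp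
      snd_structure.assoc)

lemma rev_map_lam1: "rev_map (lam1 t) = lam1 (rev_map t)"
  by (simp add: lam1_def oplus1_def)

lemma rev_map_oplus1: "rev_map (oplus1 s t) = oplus1 (rev_map t) (rev_map s)"
  by (induction s rule: free.cons_induct)
    (simp_all add: free.left_id free.right_id free.assoc rev_map_decomp)

lemma catalan_hom_M_map_cat_ops:
  "i \<ge> 1 \<Longrightarrow> catalan_hom M_map empty_tree (cat_ops i) empty_tree (cat_ops (Suc i))"
proof (induction i rule: dec_induct)
  case base
  \<comment> \<open>The order reversals of \<open>rev_map\<close> and \<open>h_map\<close> cancel,
    and \<open>cat_ops 2\<close> consists of \<open>gam\<close> and \<open>ominus\<close>.\<close>
  show ?case
    unfolding cat_ops_1
    by (simp add: catalan_hom_def M_map_def rev_map_lam1 rev_map_oplus1 h_map_lam1 h_map_oplus1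
        flip: gam_def ominus_def numeral_2_eq_2)
next
  case (step i)
  have "catalan_hom M_map empty_tree (secondary empty_tree (cat_ops i))
      empty_tree (secondary empty_tree (cat_ops (Suc i)))"
    using catalan_structure.catalan_hom_secondary[OF catalan_structure_cat_ops[of i]
        catalan_structure_cat_ops[of "Suc i"], of M_map] step
    by simp
  with step.hyps show ?case
    by (simp add: cat_ops_Suc)
qed

text \<open>Each further factor \<open>M_map\<close> raises the index of the target structure by
  one.\<close>

lemma catalan_hom_M_map_funpow:
  "catalan_hom (M_map ^^ p) empty_tree (cat_ops 1) empty_tree (cat_ops (p + 1))"
proof (induction p)
  case 0
  show ?case by (simp add: catalan_hom_id flip: id_def)
next
  case (Suc p)
  then show ?case
    using catalan_hom_comp[OF _ catalan_hom_M_map_cat_ops[of "p + 1"]] by (simp add: comp_def)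
qed

theorem theorem5p13:
  fixes p :: nat
  shows "cat_ops (p + 1) = cat_ops 1 \<longleftrightarrow> M_map ^^ p = id"
proof
  assume "cat_ops (p + 1) = cat_ops 1"
  then show "M_map ^^ p = id"
    using catalan_hom_M_map_funpow[of p] free.catalan_hom_self_eq_id by (simp only: cat_ops_1)
next
  assume "M_map ^^ p = id"
  then show "cat_ops (p + 1) = cat_ops 1"
    using catalan_hom_M_map_funpow[of p] catalan_hom_id_imp_eq by metis
qed

end
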